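(* An argument $\Gamma\rhd\Delta$ is $\{1\}$-preservation valid if and only if it is supervaluationistically valid.
   Context: Language: $\mathcal{L}$ is the propositional language with countably infinitely many atomic sentences and connectives $\neg,\lor$ (other classical connectives defined as usual). An argument $\Gamma\rhd\Delta$ is a pair of finite (possibly empty) sets $\Gamma,\Delta$ of sentences of $\mathcal{L}$. A probabilistic model is $\langle W,\mathcal{A},[\![\cdot]\!],P\rangle$ where $W$ is a nonempty set (of worlds); $\mathcal{A}\subseteq\mathcal{P}(W)$ contains $\emptyset$ and is closed under complement in $W$ and binary union; $[\![\cdot]\!]:\mathcal{L}\to\mathcal{A}$ satisfies $[\![\neg\phi]\!]=W\setminus[\![\phi]\!]$ and $[\![\phi\lor\psi]\!]=[\![\phi]\!]\cup[\![\psi]\!]$; and $P:\mathcal{A}\to[0,1]$ is a finitely additive probability ($P(\emptyset)=0$, $P(W\setminus A)=1-P(A)$, and $P(A\cup B)=P(A)+P(B)$ for disjoint $A,B\in\mathcal{A}$). Write $P(\phi)$ for $P([\![\phi]\!])$. For a set $\alpha\subseteq[0,1]$, the argument $\Gamma\rhd\Delta$ is $\alpha$-preservation valid iff in every probabilistic model, if $P(\gamma)\in\alpha$ for every $\gamma\in\Gamma$, then $P(\delta)\in\alpha$ for some $\delta\in\Delta$. The argument $\Gamma\rhd\Delta$ is supervaluationistically valid iff in every probabilistic model, if $[\![\gamma]\!]=W$ for every $\gamma\in\Gamma$, then $[\![\delta]\!]=W$ for some $\delta\in\Delta$. *)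

theory Defs
  imports "HOL-Analysis.Sigma_Algebra"
begin

datatype sentence = Atom nat | Neg sentence | Or sentence sentence

(* "algebra W A" is the library's field of sets: A is a subset of Pow W that contains {} and is
   closed under complement in W and binary union (lemma algebra_iff_Un).  The conditions on P
   concern members of A only; its values on other sets are irrelevant. *)
locale prob_model = algebra W A
  for W :: "'w set" and A :: "'w set set" +
  fixes interp :: "sentence \<Rightarrow> 'w set"
    and P :: "'w set \<Rightarrow> real"
  assumes worlds_nonempty: "W \<noteq> {}"
    and interp_in: "interp \<phi> \<in> A"
    and interp_Neg: "interp (Neg \<phi>) = W - interp \<phi>"
    and interp_Or: "interp (Or \<phi> \<psi>) = interp \<phi> \<union> interp \<psi>"
    and P_range: "X \<in> A \<Longrightarrow> P X \<in> {0..1}"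
    and P_empty: "P {} = 0"
    and P_compl: "X \<in> A \<Longrightarrow> P (W - X) = 1 - P X"
    and P_additive: "X \<in> A \<Longrightarrow> Y \<in> A \<Longrightarrow> X \<inter> Y = {} \<Longrightarrow> P (X \<union> Y) = P X + P Y"

(* HOL definitions cannot quantify over types, so validity takes the type 'w from which the worlds
   are drawn as a parameter: the models range over all nonempty sets of worlds W :: 'w set.  Results
   polymorphic in 'w cover models over every type of worlds. *)
definition preservation_valid ::
    "'w itself \<Rightarrow> real set \<Rightarrow> sentence set \<Rightarrow> sentence set \<Rightarrow> bool" where
  "preservation_valid (_ :: 'w itself) \<alpha> \<Gamma> \<Delta> \<longleftrightarrow>
     (\<forall>(W :: 'w set) A interp P. prob_model W A interp P \<longrightarrow>
        (\<forall>\<gamma>\<in>\<Gamma>. P (interp \<gamma>) \<in> \<alpha>) \<longrightarrow> (\<exists>\<delta>\<in>\<Delta>. P (interp \<delta>) \<in> \<alpha>))"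

definition supervaluationistically_valid ::
    "'w itself \<Rightarrow> sentence set \<Rightarrow> sentence set \<Rightarrow> bool" where
  "supervaluationistically_valid (_ :: 'w itself) \<Gamma> \<Delta> \<longleftrightarrow>
     (\<forall>(W :: 'w set) A interp P. prob_model W A interp P \<longrightarrow>
        (\<forall>\<gamma>\<in>\<Gamma>. interp \<gamma> = W) \<longrightarrow> (\<exists>\<delta>\<in>\<Delta>. interp \<delta> = W))"

end

theory Submission
  imports Defs
begin

text \<open>
  If all premises have probability 1, so does the intersection of their (finitely many) extensions.
  Conditionalising on that event makes the premises true everywhere, so some conclusion contains the
  event and has probability 1. Conversely, if every conclusion fails at some world, the uniform
  distribution on finitely many such counter-worlds gives every conclusion probability less than 1,
  while sentences true everywhere keep probability 1.
\<close>

context prob_model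
begin

lemma P_space: "P W = 1"
  using P_compl[of "{}"] P_empty by simp

lemma P_mono:
  assumes "X \<in> A" "Y \<in> A" "X \<subseteq> Y"
  shows "P X \<le> P Y"
proof -
  have "P (X \<union> (Y - X)) = P X + P (Y - X)"
    using assms by (intro P_additive) auto
  moreover have "X \<union> (Y - X) = Y" using assms by auto
  moreover have "0 \<le> P (Y - X)" using P_range[of "Y - X"] assms by auto
  ultimately show ?thesis by simp
qed

text \<open>The part of \<open>X\<close> outside \<open>Y\<close> lies in the complement of
  \<open>Y\<close>, which has probability 0, so cutting it away costs \<open>X\<close>
  nothing.\<close>

lemma P_Int_eq_1:
  assumes "X \<in> A" "Y \<in> A" "P X = 1" "P Y = 1"
  shows "P (X \<inter> Y) = 1"
proof -
  have "P (X \<inter> Y) + P (X - Y) = P (X \<inter> Y \<union> (X - Y))"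
    using assms by (intro P_additive[symmetric]) auto
  also have "X \<inter> Y \<union> (X - Y) = X" by auto
  finally have "P (X \<inter> Y) + P (X - Y) = 1" using assms by simp
  moreover have "P (X - Y) \<le> P (W - Y)"
    using assms sets_into_space by (intro P_mono) auto
  moreover have "P (X \<inter> Y) \<le> 1" using P_range[of "X \<inter> Y"] assms by auto
  ultimately show ?thesis using P_compl[of Y] assms by simp
qed

text \<open>Intersecting with \<open>W\<close> turns the empty intersection into the whole space
  instead of \<open>UNIV\<close>, so the induction can start from \<open>P_space\<close>.\<close>

lemma P_Inter_interp_eq_1:
  assumes "finite \<Gamma>" "\<And>\<gamma>. \<gamma> \<in> \<Gamma> \<Longrightarrow> P (interp \<gamma>) = 1"
  shows "W \<inter> (\<Inter>\<gamma>\<in>\<Gamma>. interp \<gamma>) \<in> A \<and> P (W \<inter> (\<Inter>\<gamma>\<in>\<Gamma>. interp \<gamma>)) = 1"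
  using assms
proof (induction \<Gamma>)
  case empty
  then show ?case using P_space by simp
next
  case (insert \<gamma> \<Gamma>)
  let ?E = "W \<inter> (\<Inter>\<gamma>\<in>\<Gamma>. interp \<gamma>)"
  have E: "?E \<in> A" "P ?E = 1" using insert by auto
  have "W \<inter> (\<Inter>\<gamma>\<in>insert \<gamma> \<Gamma>. interp \<gamma>) = interp \<gamma> \<inter> ?E" by auto
  then show ?case using E insert.prems interp_in P_Int_eq_1 by auto
qed

text \<open>Since \<open>P E = 1\<close>, conditioning on \<open>E\<close> needs no renormalisation:
  \<open>P\<close> itself, read on the events inside \<open>E\<close>, is the conditional
  probability. Complements are now taken in \<open>E\<close>, so their rule is derived from
  additivity.\<close>

lemma prob_model_restrict:
  assumes E: "E \<in> A" "P E = 1"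
  shows "prob_model E {X \<in> A. X \<subseteq> E} (\<lambda>\<phi>. interp \<phi> \<inter> E) P"
proof -
  interpret R: algebra E "{X \<in> A. X \<subseteq> E}"
    using E by (auto simp: algebra_iff_Un)
  show ?thesis
  proof
    show "E \<noteq> {}" using E P_empty by auto
    fix X assume X: "X \<in> {X \<in> A. X \<subseteq> E}"
    have "P (X \<union> (E - X)) = P X + P (E - X)"
      using X E by (intro P_additive) auto
    moreover have "X \<union> (E - X) = E" using X by auto
    ultimately show "P (E - X) = 1 - P X" using E by simp
  qed (use E sets_into_space[OF E(1)] interp_in interp_Neg interp_Or P_empty P_range P_additive in auto)
qed

text \<open>Only the probability changes; \<open>W\<close>, \<open>A\<close> and
  \<open>interp\<close> stay, and so does which sentences hold at every world. The new measure
  counts points of \<open>S\<close>, so an event gets value 1 exactly if it contains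
  \<open>S\<close>.\<close>

lemma prob_model_uniform:
  assumes S: "finite S" "S \<noteq> {}" "S \<subseteq> W"
  shows "prob_model W A interp (\<lambda>X. real (card (X \<inter> S)) / real (card S))"
proof
  have pos: "card S > 0" using S by (simp add: card_gt_0_iff)
  fix X assume X: "X \<in> A"
  show "real (card (X \<inter> S)) / real (card S) \<in> {0..1}"
    using pos S by (auto simp: divide_le_eq_1 intro: card_mono)
  have "(W - X) \<inter> S = S - X \<inter> S" using S by auto
  then have "card ((W - X) \<inter> S) = card S - card (X \<inter> S)"
    using S by (simp add: card_Diff_subset)
  \<comment> \<open>This bound lets the subtraction of naturals pass to the reals.\<close>
  moreover have "card (X \<inter> S) \<le> card S" using S by (auto intro: card_mono)
  ultimately show "real (card ((W - X) \<inter> S)) / real (card S) = 1 - real (card (X \<inter> S)) / real (card S)"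
    using pos by (simp add: of_nat_diff field_simps)
  fix Y assume "X \<inter> Y = {}"
  then have "card ((X \<union> Y) \<inter> S) = card (X \<inter> S) + card (Y \<inter> S)"
    using S by (subst card_Un_disjoint[symmetric]) (auto simp: Int_Un_distrib2)
  then show "real (card ((X \<union> Y) \<inter> S)) / real (card S)
      = real (card (X \<inter> S)) / real (card S) + real (card (Y \<inter> S)) / real (card S)"
    by (simp add: add_divide_distrib)
qed (use worlds_nonempty interp_in interp_Neg interp_Or in auto)

end

lemma supervaluationistically_valid_imp_preservation_valid:
  assumes "finite \<Gamma>" and valid: "supervaluationistically_valid TYPE('w) \<Gamma> \<Delta>"
  shows "preservation_valid TYPE('w) {1} \<Gamma> \<Delta>"
  unfolding preservation_valid_def
proof (intro allI impI)
  fix W :: "'w set" and A interp P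
  assume "prob_model W A interp P" and prem: "\<forall>\<gamma>\<in>\<Gamma>. P (interp \<gamma>) \<in> {1}"
  then interpret prob_model W A interp P by simp
  define E where "E = W \<inter> (\<Inter>\<gamma>\<in>\<Gamma>. interp \<gamma>)"
  have E: "E \<in> A" "P E = 1"
    using P_Inter_interp_eq_1[OF \<open>finite \<Gamma>\<close>] prem by (auto simp: E_def)
  \<comment> \<open>In the model restricted to \<open>E\<close>, this says that every premise holds
    at all worlds.\<close>
  have "\<forall>\<gamma>\<in>\<Gamma>. interp \<gamma> \<inter> E = E" by (auto simp: E_def)
  then obtain \<delta> where \<delta>: "\<delta> \<in> \<Delta>" "interp \<delta> \<inter> E = E"
    using valid prob_model_restrict[OF E] unfolding supervaluationistically_valid_def by blast
  \<comment> \<open>The choice of \<delta> means that \<open>interp \<delta>\<close> contains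
    \<open>E\<close>, an event of probability 1.\<close>
  have "1 \<le> P (interp \<delta>)" using P_mono[of E "interp \<delta>"] E \<delta> interp_in by auto
  then have "P (interp \<delta>) = 1" using P_range[OF interp_in, of \<delta>] by simp
  then show "\<exists>\<delta>\<in>\<Delta>. P (interp \<delta>) \<in> {1}" using \<delta> by auto
qed

lemma preservation_valid_imp_supervaluationistically_valid:
  assumes "finite \<Delta>" and valid: "preservation_valid TYPE('w) {1} \<Gamma> \<Delta>"
  shows "supervaluationistically_valid TYPE('w) \<Gamma> \<Delta>"
  unfolding supervaluationistically_valid_def
proof (intro allI impI)
  fix W :: "'w set" and A interp P
  assume "prob_model W A interp P" and prem: "\<forall>\<gamma>\<in>\<Gamma>. interp \<gamma> = W"
  then interpret prob_model W A interp P by simp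
  show "\<exists>\<delta>\<in>\<Delta>. interp \<delta> = W"
  proof (rule ccontr)
    assume "\<not> (\<exists>\<delta>\<in>\<Delta>. interp \<delta> = W)"
    then have "\<forall>\<delta>\<in>\<Delta>. \<exists>w. w \<in> W - interp \<delta>"
      using sets_into_space[OF interp_in] by blast
    \<comment> \<open>One counter-world is chosen per conclusion, so finitely many conclusions need
      only a finite support.\<close>
    then obtain f where f: "\<And>\<delta>. \<delta> \<in> \<Delta> \<Longrightarrow> f \<delta> \<in> W - interp \<delta>" by metis
    obtain w where w: "w \<in> W" using worlds_nonempty by auto
    \<comment> \<open>The extra world keeps the support nonempty when there are no conclusions.\<close>
    define S where "S = insert w (f ` \<Delta>)"
    have S: "finite S" "S \<noteq> {}" "S \<subseteq> W"
      using \<open>finite \<Delta>\<close> f w by (auto simp: S_def)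
    let ?Q = "\<lambda>X. real (card (X \<inter> S)) / real (card S)"
    have "\<forall>\<gamma>\<in>\<Gamma>. ?Q (interp \<gamma>) \<in> {1}"
      using prem S by (auto simp: Int_absorb1)
    then obtain \<delta> where \<delta>: "\<delta> \<in> \<Delta>" "?Q (interp \<delta>) \<in> {1}"
      using valid prob_model_uniform[OF S] unfolding preservation_valid_def by blast
    \<comment> \<open>The world \<open>f \<delta>\<close> lies in \<open>S\<close> but outside
      \<open>interp \<delta>\<close>.\<close>
    have "interp \<delta> \<inter> S \<subset> S" using f[OF \<delta>(1)] \<delta>(1) by (auto simp: S_def)
    then have "card (interp \<delta> \<inter> S) < card S" using S by (intro psubset_card_mono)
    then show False using \<delta>(2) by (auto simp: divide_eq_1_iff)
  qed
qed

theorem fact11: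
  fixes \<Gamma> \<Delta> :: "sentence set"
  assumes "finite \<Gamma>" and "finite \<Delta>"
  shows "preservation_valid TYPE('w) {1} \<Gamma> \<Delta> \<longleftrightarrow>
         supervaluationistically_valid TYPE('w) \<Gamma> \<Delta>"
  using assms supervaluationistically_valid_imp_preservation_valid
    preservation_valid_imp_supervaluationistically_valid by blast

end
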